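(* Let $f\in L^\infty(\mathbb R^+;H^1(\mathbb R))$ with $\partial_Xf\in L^\infty(\mathbb R^+\times\mathbb R)$, and let $$h_R(t,X):=\frac12\int_0^t\partial_Xf(\tau,X-t+\tau)\,d\tau .$$ Then for all $X\in\mathbb R$, $t>0$, $$|h_R(t,X)|\le\frac t2|\partial_Xf|_\infty .$$ Furthermore, if $f(t,X)=f_0(X-t)$ with $f_0\in H^1(\mathbb R)$ and $|f_0'(X_0-t_0)|=|f_0'|_\infty$, then equality holds at $(t_0,X_0)$. If $f(t,X)=f_0(X-Ut)$ with $f_0\in H^1(\mathbb R)$ and $U\ne1$, then $$|h_R(t,\cdot)|_\infty\le\min\left(\frac{|f_0|_\infty}{|1-U|},\ \frac t2|f_0'|_\infty\right).$$
   Context: $|\cdot|_\infty$ denotes the $L^\infty$ norm. Here $t\ge 0$ is time, $X\in\mathbb R$ space (one-dimensional case), and $f=P+b$ represents a moving disturbance (sum of surface pressure and bottom deformation). The quantity $h_R$ is the right-going contribution in d'Alembert's formula $h=h_T+h_L-h_R$ for the solution of $\partial_t^2h-\partial_X^2h=\partial_X^2f$, $h|_{t=0}=-b(0,\cdot)$, $\partial_th|_{t=0}=0$, where $h_T(t,X)=-\frac12(b(0,X-t)+b(0,X+t))$ and $h_L(t,X)=\frac12\int_0^t\partial_Xf(\tau,X+t-\tau)d\tau$. *)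

theory Defs
  imports "HOL-Probability.Essential_Supremum"
begin

definition Linf_norm :: "'a measure \<Rightarrow> ('a \<Rightarrow> real) \<Rightarrow> ereal"
  where "Linf_norm M g = esssup M (\<lambda>x. ereal \<bar>g x\<bar>)"

definition in_Linf :: "'a measure \<Rightarrow> ('a \<Rightarrow> real) \<Rightarrow> bool"
  where "in_Linf M g \<longleftrightarrow> g \<in> borel_measurable M \<and> Linf_norm M g < \<infinity>"

definition in_L2 :: "(real \<Rightarrow> real) \<Rightarrow> bool"
  where "in_L2 u \<longleftrightarrow> u \<in> borel_measurable lebesgue \<and> integrable lebesgue (\<lambda>x. (u x)\<^sup>2)"

definition locally_integrable :: "(real \<Rightarrow> real) \<Rightarrow> bool"
  where "locally_integrable u \<longleftrightarrow> (\<forall>a b. u absolutely_integrable_on {a..b})"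

definition test_function :: "(real \<Rightarrow> real) \<Rightarrow> bool"
  where "test_function \<phi> \<longleftrightarrow>
    (\<forall>n. (deriv ^^ n) \<phi> differentiable_on UNIV) \<and> compact (closure {x. \<phi> x \<noteq> 0})"

definition has_weak_deriv :: "(real \<Rightarrow> real) \<Rightarrow> (real \<Rightarrow> real) \<Rightarrow> bool"
  where "has_weak_deriv u g \<longleftrightarrow> locally_integrable u \<and> locally_integrable g \<and>
    (\<forall>\<phi>. test_function \<phi> \<longrightarrow>
      (LINT x|lebesgue. u x * deriv \<phi> x) = - (LINT x|lebesgue. g x * \<phi> x))"

text \<open>
  The precise representative of a locally integrable function: the limit of its symmetric
  averages where that limit exists, and 0 elsewhere. It agrees with the function almost everywhere
  (Lebesgue differentiation) and at every point of continuity, and it depends only on the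
  almost-everywhere class of the function.
\<close>

definition precise_rep :: "(real \<Rightarrow> real) \<Rightarrow> real \<Rightarrow> real"
  where "precise_rep g x =
    (let avg = (\<lambda>r. (LINT y:{x - r..x + r}|lebesgue. g y) / (2 * r))
     in if \<exists>l. (avg \<longlongrightarrow> l) (at_right 0) then Lim (at_right 0) avg else 0)"

text \<open>
  The weak derivative is determined only up to null sets, whereas the integrals below run along
  lines, which are null sets of the plane, and single values of the derivative are used.
  Hence \<^term>\<open>wderiv u\<close> below is the precise representative of the weak derivative of u; the
  result does not depend on the choice made by SOME.
\<close>

definition wderiv :: "(real \<Rightarrow> real) \<Rightarrow> real \<Rightarrow> real"
  where "wderiv u = precise_rep (SOME g. has_weak_deriv u g)"

definition in_H1 :: "(real \<Rightarrow> real) \<Rightarrow> bool"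
  where "in_H1 u \<longleftrightarrow> in_L2 u \<and> (\<exists>g. has_weak_deriv u g \<and> in_L2 g)"

definition H1_norm :: "(real \<Rightarrow> real) \<Rightarrow> real"
  where "H1_norm u = sqrt ((LINT x|lebesgue. (u x)\<^sup>2) + (LINT x|lebesgue. (wderiv u x)\<^sup>2))"

text \<open>
  Bochner measurability of a map from the half-line to H1: almost everywhere the limit,
  in H1-norm, of a sequence of simple functions with values in H1.
\<close>

definition H1_strongly_measurable :: "(real \<Rightarrow> real \<Rightarrow> real) \<Rightarrow> bool"
  where "H1_strongly_measurable f \<longleftrightarrow>
    (\<exists>s :: nat \<Rightarrow> real \<Rightarrow> real \<Rightarrow> real.
      (\<forall>n. simple_function (lebesgue_on {0..}) (s n) \<and> (\<forall>t\<ge>0. in_H1 (s n t))) \<and>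
      (AE t in lebesgue_on {0..}. (\<lambda>n. H1_norm (\<lambda>x. s n t x - f t x)) \<longlonglongrightarrow> 0))"

definition in_Linf_H1 :: "(real \<Rightarrow> real \<Rightarrow> real) \<Rightarrow> bool"
  where "in_Linf_H1 f \<longleftrightarrow>
    (AE t in lebesgue_on {0..}. in_H1 (f t)) \<and> H1_strongly_measurable f \<and>
    (\<exists>C. AE t in lebesgue_on {0..}. H1_norm (f t) \<le> C)"

definition dX :: "(real \<Rightarrow> real \<Rightarrow> real) \<Rightarrow> real \<times> real \<Rightarrow> real"
  where "dX f = (\<lambda>(t, x). wderiv (f t) x)"

abbreviation half_plane :: "(real \<times> real) measure"
  where "half_plane \<equiv> lebesgue_on ({0..} \<times> UNIV)"

definition h_R :: "(real \<Rightarrow> real \<Rightarrow> real) \<Rightarrow> real \<Rightarrow> real \<Rightarrow> real"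
  where "h_R f t X = 1 / 2 * (LINT \<tau>:{0..t}|lebesgue. dX f (\<tau>, X - t + \<tau>))"

end

theory Submission
  imports Defs "HOL-Computational_Algebra.Polynomial"
begin

text \<open>
  The precise representative is a limit of averages, so for almost every time the essential bound
  on the derivative holds at every point of space, in particular along the line of integration;
  this gives the general bound. For a profile moving with speed U, the derivative at
  \<open>(\<tau>, X - t + \<tau>)\<close> is that of \<open>f\<^sub>0\<close> at \<open>X - t + (1 - U) * \<tau>\<close>: it is constant in \<open>\<tau>\<close> if
  \<open>U = 1\<close>, which gives equality, and otherwise
  \<open>h_R f t X = (F (X - U * t) - F (X - t)) / (2 * (1 - U))\<close>
  for the continuous representative F of \<open>f\<^sub>0\<close>. That F is a primitive of the weak derivative
  follows by testing with smooth approximations of the indicator function of an interval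
  and passing to the limit at Lebesgue points.
\<close>

subsection \<open>Smooth step functions\<close>

text \<open>The differentiability half of \<open>test_function\<close>, split off so that closure
  properties can be proved without regard to supports.\<close>

definition smooth :: "(real \<Rightarrow> real) \<Rightarrow> bool"
  where "smooth f \<longleftrightarrow> (\<forall>n. (deriv ^^ n) f differentiable_on UNIV)"

text \<open>The smooth functions form the largest class of differentiable functions closed under
  \<open>deriv\<close>. Exhibiting one such class around \<open>f\<close> therefore suffices, and no
  formula for higher derivatives is ever required.\<close>

lemma smooth_coinduct:
  assumes "P f" and "\<And>f. P f \<Longrightarrow> f differentiable_on UNIV \<and> P (deriv f)"
  shows "smooth f"
proof -
  have "P ((deriv ^^ n) f)" for n
    by (induction n) (use assms in auto)
  then show ?thesis
    using assms(2) by (auto simp: smooth_def)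
qed

lemma smooth_imp_differentiable: "smooth f \<Longrightarrow> f differentiable_on UNIV"
  unfolding smooth_def by (metis funpow_0)

lemma smooth_deriv: "smooth f \<Longrightarrow> smooth (deriv f)"
  unfolding smooth_def by (metis comp_apply funpow_Suc_right)

lemma smooth_has_derivative: "smooth f \<Longrightarrow> (f has_real_derivative deriv f x) (at x)"
  using smooth_imp_differentiable[of f]
  by (simp add: differentiable_on_def DERIV_deriv_iff_real_differentiable)

lemma smooth_mult:
  assumes "smooth f" "smooth g"
  shows "smooth (\<lambda>x. f x * g x)"
proof -
  \<comment> \<open>Single products are not closed under differentiation, finite sums of them are.\<close>
  define C where "C h \<longleftrightarrow> (\<exists>ps. h = (\<lambda>x. \<Sum>(f, g)\<leftarrow>ps. f x * g x) \<and> (\<forall>(f, g)\<in>set ps. smooth f \<and> smooth g))"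
    for h :: "real \<Rightarrow> real"
  have sum_deriv: "((\<lambda>x. \<Sum>(f, g)\<leftarrow>ps. f x * g x) has_real_derivative
        (\<Sum>(f, g)\<leftarrow>concat (map (\<lambda>(f, g). [(deriv f, g), (f, deriv g)]) ps). f x * g x)) (at x)"
    if "\<forall>(f, g)\<in>set ps. smooth f \<and> smooth g" for ps x
    using that
  proof (induction ps)
    case (Cons p ps)
    then show ?case
      by (cases p) (auto intro!: derivative_eq_intros smooth_has_derivative simp: add.assoc)
  qed simp
  have "h differentiable_on UNIV \<and> C (deriv h)" if h_C: "C h" for h
  proof -
    obtain ps where h: "h = (\<lambda>x. \<Sum>(f, g)\<leftarrow>ps. f x * g x)"
      and ps: "\<forall>(f, g)\<in>set ps. smooth f \<and> smooth g"
      using h_C unfolding C_def by blast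
    define qs where "qs = concat (map (\<lambda>(f, g). [(deriv f, g), (f, deriv g)]) ps)"
    have d: "(h has_real_derivative (\<Sum>(f, g)\<leftarrow>qs. f x * g x)) (at x)" for x
      unfolding h qs_def by (rule sum_deriv[OF ps])
    have "\<forall>(f, g)\<in>set qs. smooth f \<and> smooth g"
      using ps by (auto simp: qs_def smooth_deriv)
    moreover have "deriv h = (\<lambda>x. \<Sum>(f, g)\<leftarrow>qs. f x * g x)"
      using DERIV_imp_deriv[OF d] by auto
    ultimately have "C (deriv h)"
      unfolding C_def by blast
    moreover have "h differentiable_on UNIV"
      using d by (meson differentiable_at_imp_differentiable_on real_differentiable_def)
    ultimately show ?thesis by blast
  qed
  moreover have "C (\<lambda>x. f x * g x)"
    unfolding C_def using assms by (intro exI[of _ "[(f, g)]"]) auto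
  ultimately show ?thesis
    using smooth_coinduct[of C] by blast
qed

lemma smooth_const: "smooth (\<lambda>x. c)"
  by (rule smooth_coinduct[of "\<lambda>f. \<exists>c. f = (\<lambda>x. c)"]) auto

lemma smooth_affine:
  assumes "smooth f"
  shows "smooth (\<lambda>x. f (m * x + k))"
proof -
  \<comment> \<open>The constant \<open>c\<close> absorbs the factor \<open>m\<close> that every
    differentiation produces.\<close>
  define C where "C h \<longleftrightarrow> (\<exists>g c. smooth g \<and> h = (\<lambda>x. c * g (m * x + k)))" for h :: "real \<Rightarrow> real"
  have "h differentiable_on UNIV \<and> C (deriv h)" if h_C: "C h" for h
  proof -
    obtain g c where g: "smooth g" and h: "h = (\<lambda>x. c * g (m * x + k))"
      using h_C unfolding C_def by blast
    have d: "(h has_real_derivative (c * m) * deriv g (m * x + k)) (at x)" for x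
      unfolding h
      by (rule derivative_eq_intros DERIV_chain2[OF smooth_has_derivative[OF g]] refl)+ simp
    have "deriv h = (\<lambda>x. (c * m) * deriv g (m * x + k))"
      using DERIV_imp_deriv[OF d] by auto
    then have "C (deriv h)"
      unfolding C_def using smooth_deriv[OF g] by blast
    moreover have "h differentiable_on UNIV"
      using d by (meson differentiable_at_imp_differentiable_on real_differentiable_def)
    ultimately show ?thesis by blast
  qed
  moreover have "C (\<lambda>x. f (m * x + k))"
    unfolding C_def using assms by (intro exI[of _ f] exI[of _ 1]) auto
  ultimately show ?thesis
    using smooth_coinduct[of C] by blast
qed

lemma smooth_diff:
  assumes "smooth f" "smooth g"
  shows "smooth (\<lambda>x. f x - g x)"
proof (rule smooth_coinduct[of "\<lambda>h. \<exists>f g. smooth f \<and> smooth g \<and> h = (\<lambda>x. f x - g x)"])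
  fix h :: "real \<Rightarrow> real"
  assume "\<exists>f g. smooth f \<and> smooth g \<and> h = (\<lambda>x. f x - g x)"
  then obtain f g where fg: "smooth f" "smooth g" and h: "h = (\<lambda>x. f x - g x)"
    by blast
  have d: "(h has_real_derivative (deriv f x - deriv g x)) (at x)" for x
    unfolding h by (intro DERIV_diff smooth_has_derivative fg)
  have "deriv h = (\<lambda>x. deriv f x - deriv g x)"
    using DERIV_imp_deriv[OF d] by auto
  moreover have "h differentiable_on UNIV"
    using d by (meson differentiable_at_imp_differentiable_on real_differentiable_def)
  ultimately show "h differentiable_on UNIV \<and> (\<exists>f g. smooth f \<and> smooth g \<and> deriv h = (\<lambda>x. f x - g x))"
    using smooth_deriv fg by blast
qed (use assms in blast)

text \<open>Adjoining \<open>f\<close> to the smooth functions keeps the class closed under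
  differentiation, since \<open>deriv f\<close> is \<open>g\<close>.\<close>

lemma smooth_antiderivative:
  assumes "smooth g" and "\<And>x. (f has_real_derivative g x) (at x)"
  shows "smooth f"
proof (rule smooth_coinduct[of "\<lambda>h. smooth h \<or> h = f"])
  have "deriv f = g"
    using DERIV_imp_deriv[OF assms(2)] by auto
  moreover have "f differentiable_on UNIV"
    using assms(2) by (meson differentiable_at_imp_differentiable_on real_differentiable_def)
  ultimately show "h differentiable_on UNIV \<and> (smooth (deriv h) \<or> deriv h = f)"
    if "smooth h \<or> h = f" for h
    using that assms(1) smooth_deriv smooth_imp_differentiable by auto
qed simp

section \<open>Functions flat at the origin and the smooth step\<close>

definition flat :: "real poly \<Rightarrow> real \<Rightarrow> real"
  where "flat p x = (if x > 0 then poly p (1 / x) * exp (- 1 / x) else 0)"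

lemma poly_mult_exp_minus_tendsto_0:
  fixes p :: "real poly"
  shows "((\<lambda>y. poly p y * exp (- y)) \<longlongrightarrow> 0) at_top"
proof -
  have "((\<lambda>y. \<Sum>i\<le>degree p. coeff p i * (y ^ i / exp y)) \<longlongrightarrow> (\<Sum>i\<le>degree p. coeff p i * 0)) at_top"
    by (intro tendsto_sum tendsto_mult tendsto_const tendsto_power_div_exp_0)
  then show ?thesis
    by (simp add: poly_altdef exp_minus divide_inverse sum_distrib_right mult.assoc)
qed

text \<open>With y = 1/x the derivative of p(y) exp(-y) is y^2 (p(y) - p'(y)) exp(-y), and the
  polynomial \<open>[:0, 0, 1:]\<close> is y^2; so the family is closed under differentiation. At 0
  the right difference quotient is y p(y) exp(-y), which tends to 0 as y grows.\<close>

lemma flat_has_derivative: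
  "(flat p has_real_derivative flat ([:0, 0, 1:] * (p - pderiv p)) x) (at x)"
proof -
  consider "x > 0" | "x < 0" | "x = 0" by linarith
  then show ?thesis
  proof cases
    case 1
    have "((\<lambda>x. poly p (1 / x) * exp (- 1 / x)) has_real_derivative
        flat ([:0, 0, 1:] * (p - pderiv p)) x) (at x)"
      using 1
      by (auto intro!: derivative_eq_intros DERIV_chain2[OF poly_DERIV]
          simp: flat_def field_simps power2_eq_square)
    then show ?thesis
      by (rule has_field_derivative_transform_within[of _ _ _ _ x])
        (use 1 in \<open>auto simp: flat_def dist_real_def\<close>)
  next
    case 2
    have "((\<lambda>x. 0) has_real_derivative flat ([:0, 0, 1:] * (p - pderiv p)) x) (at x)"
      using 2 by (simp add: flat_def)
    then show ?thesis
      by (rule has_field_derivative_transform_within[of _ _ _ _ "- x"])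
        (use 2 in \<open>auto simp: flat_def dist_real_def\<close>)
  next
    case 3
    have "((\<lambda>y. poly ([:0, 1:] * p) (inverse y) * exp (- inverse y)) \<longlongrightarrow> 0) (at_right 0)"
      by (rule filterlim_compose[OF poly_mult_exp_minus_tendsto_0 filterlim_inverse_at_top_right])
    then have "((\<lambda>y. flat p y / y) \<longlongrightarrow> 0) (at_right 0)"
      by (rule Lim_transform_eventually)
        (auto simp: eventually_at flat_def field_simps intro!: exI[of _ 1])
    moreover have "((\<lambda>y. flat p y / y) \<longlongrightarrow> 0) (at_left 0)"
      by (rule tendsto_eventually)
        (auto simp: eventually_at flat_def intro!: exI[of _ 1])
    ultimately have "((\<lambda>y. flat p y / y) \<longlongrightarrow> 0) (at 0)"
      by (simp add: filterlim_split_at)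
    then show ?thesis
      using 3 by (simp add: has_field_derivative_iff flat_def)
  qed
qed

lemma smooth_flat: "smooth (flat p)"
proof (rule smooth_coinduct[of "\<lambda>f. \<exists>p. f = flat p"])
  fix f assume "\<exists>p. f = flat p"
  then obtain p where f: "f = flat p" by blast
  show "f differentiable_on UNIV \<and> (\<exists>p. deriv f = flat p)"
  proof
    show "f differentiable_on UNIV"
      unfolding f using flat_has_derivative
      by (meson differentiable_at_imp_differentiable_on real_differentiable_def)
    have "deriv f = flat ([:0, 0, 1:] * (p - pderiv p))"
      unfolding f using DERIV_imp_deriv[OF flat_has_derivative[of p]] by (rule ext)
    then show "\<exists>p. deriv f = flat p" by blast
  qed
qed blast

text \<open>The step is the normalised primitive of the bump exp(-1/x) exp(-1/(1-x)) supported in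
  [0, 1]. It is constant on both sides of the support and monotone because the bump is
  nonnegative.\<close>

lemma smooth_step_exists:
  obtains S s :: "real \<Rightarrow> real" and K
  where "smooth S" "\<And>x. (S has_real_derivative s x) (at x)"
    "continuous_on UNIV s" "\<And>x. x \<notin> {0..1} \<Longrightarrow> s x = 0" "\<And>x. \<bar>s x\<bar> \<le> K"
    "\<And>x. x \<le> 0 \<Longrightarrow> S x = 0" "\<And>x. x \<ge> 1 \<Longrightarrow> S x = 1" "\<And>x. 0 \<le> S x" "\<And>x. S x \<le> 1"
proof -
  define b where "b x = flat 1 x * flat 1 (1 - x)" for x
  have "smooth (\<lambda>x. flat 1 x * flat 1 (- 1 * x + 1))"
    by (intro smooth_mult smooth_affine smooth_flat)
  then have smooth_b: "smooth b"
    unfolding b_def by simp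
  then have cont_b: "continuous_on A b" for A
    by (meson DERIV_isCont continuous_at_imp_continuous_on smooth_has_derivative)
  have b0: "b x = 0" if "x \<notin> {0..1}" for x
    using that by (auto simp: b_def flat_def)
  have b_nonneg: "b x \<ge> 0" for x
    by (simp add: b_def flat_def)
  have b_pos: "b x > 0" if "0 < x" "x < 1" for x
    using that by (simp add: b_def flat_def)
  \<comment> \<open>Starting at -1, to the left of the support, leaves room for a two-sided
    derivative at 0. Up to -1 the integral is 0, so the remaining points need only the zero
    function.\<close>
  define B where "B x = integral {-1..x} b" for x
  have B0: "B x = 0" if "x \<le> 0" for x
  proof -
    \<comment> \<open>The fact \<open>b0\<close> leaves out the endpoint 0, where the factor
      \<open>flat 1 y\<close> vanishes.\<close>
    have "b y = 0" if "y \<in> {-1..x}" for y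
      using b0[of y] \<open>x \<le> 0\<close> that by (cases "y = 0") (auto simp: b_def flat_def)
    then show ?thesis
      unfolding B_def by (subst integral_cong[of _ b "\<lambda>_. 0"]) auto
  qed
  have dB: "(B has_real_derivative b x) (at x)" for x
  proof (cases "x > -1")
    case True
    have "((\<lambda>u. integral {-1..u} b) has_real_derivative b x) (at x within {-1..x + 1})"
      by (rule integral_has_real_derivative) (use True cont_b in auto)
    moreover have "at x within {-1..x + 1} = at x"
      by (rule at_within_interior) (use True in \<open>auto simp: interior_atLeastAtMost_real\<close>)
    ultimately show ?thesis by (simp add: B_def[abs_def])
  next
    case False
    have "((\<lambda>x. 0) has_real_derivative b x) (at x)"
      using b0[of x] False by simp
    then show ?thesis
      by (rule has_field_derivative_transform_within[of _ _ _ _ 1])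
        (use False in \<open>auto simp: B0 dist_real_def\<close>)
  qed
  have mono: "B x \<le> B y" if "x \<le> y" for x y
    by (rule DERIV_nonneg_imp_nondecreasing[OF that]) (use dB b_nonneg in blast)
  have B1: "B x = B 1" if "x \<ge> 1" for x
  proof (cases "x = 1")
    case False
    have "(B has_real_derivative 0) (at y)" if "1 < y" for y
      using dB[of y] b0[of y] that by simp
    then show ?thesis
      using that False dB
      by (intro DERIV_isconst_end) (auto intro!: continuous_at_imp_continuous_on DERIV_isCont)
  qed simp
  have pos: "B 1 > 0"
  proof -
    have "B 0 < B 1"
      by (rule DERIV_pos_imp_increasing_open)
        (use dB b_pos in \<open>auto intro!: continuous_at_imp_continuous_on DERIV_isCont\<close>)
    then show ?thesis by (simp add: B0)
  qed
  have "compact (b ` {0..1})"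
    by (intro compact_continuous_image cont_b) auto
  then obtain K where K: "\<And>x. x \<in> {0..1} \<Longrightarrow> norm (b x) \<le> K"
    by (metis bounded_iff compact_imp_bounded imageI)
  have K': "\<bar>b x\<bar> \<le> K" for x
    using K[of x] K[of 0] b0[of x] norm_ge_zero[of "b 0"] by (cases "x \<in> {0..1}") auto
  define S where "S x = B x / B 1" for x
  define s where "s x = b x / B 1" for x
  have dS: "(S has_real_derivative s x) (at x)" for x
    unfolding S_def s_def by (intro DERIV_cdivide dB)
  have "smooth (\<lambda>x. b x * (1 / B 1))"
    by (intro smooth_mult smooth_b smooth_const)
  then have "smooth s"
    by (simp add: s_def[abs_def])
  show ?thesis
  proof (rule that[of S s "K / B 1"])
    show "smooth S"
      using \<open>smooth s\<close> dS by (rule smooth_antiderivative)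
    show "continuous_on UNIV s"
      unfolding s_def by (intro continuous_intros cont_b) (use pos in auto)
    show "0 \<le> S x" for x
      using mono[of "min x 0" x] B0[of "min x 0"] pos by (simp add: S_def)
    show "S x \<le> 1" for x
      using mono[of x "max x 1"] B1[of "max x 1"] pos by (simp add: S_def)
    show "S x = 1" if "x \<ge> 1" for x
      unfolding S_def B1[OF that] using pos by simp
  qed (use dS b0 K' B0 pos in \<open>auto simp: S_def s_def divide_right_mono\<close>)
qed

subsection \<open>Lebesgue points of locally integrable functions\<close>

lemma locally_integrable_integrable_on:
  "locally_integrable u \<Longrightarrow> u integrable_on {a..b}"
  unfolding locally_integrable_def by (blast intro: set_lebesgue_integral_eq_integral(1))

lemma locally_integrable_LINT:
  "locally_integrable u \<Longrightarrow> (LINT x:{a..b}|lebesgue. u x) = integral {a..b} u"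
  unfolding locally_integrable_def by (blast intro: set_lebesgue_integral_eq_integral(2))

lemma locally_integrable_const: "locally_integrable (\<lambda>x. c)"
  unfolding locally_integrable_def
  using absolutely_integrable_continuous_real[of _ _ "\<lambda>x. c"] by auto

lemma locally_integrable_diff:
  "locally_integrable u \<Longrightarrow> locally_integrable v \<Longrightarrow> locally_integrable (\<lambda>x. u x - v x)"
  unfolding locally_integrable_def by (blast intro: set_integral_diff)

lemma locally_integrable_abs:
  "locally_integrable u \<Longrightarrow> locally_integrable (\<lambda>x. \<bar>u x\<bar>)"
  unfolding locally_integrable_def by (blast intro: set_integrable_abs)

lemma locally_integrable_affine:
  assumes u: "locally_integrable u" and m: "m \<noteq> 0"
  shows "locally_integrable (\<lambda>x. u (c + m * x))"
  unfolding locally_integrable_def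
proof (intro allI)
  fix a b
  \<comment> \<open>The endpoints of the image of [a, b], sorted so that both signs of
    \<open>m\<close> are covered.\<close>
  define l r where "l = min (c + m * a) (c + m * b)" and "r = max (c + m * a) (c + m * b)"
  have "integrable lebesgue (\<lambda>x. indicator {l..r} x *\<^sub>R u x)"
    using u by (simp add: locally_integrable_def set_integrable_def)
  then have "integrable lebesgue (\<lambda>x. indicator {l..r} (c + m * x) *\<^sub>R u (c + m * x))"
    using m by (rule lebesgue_integrable_real_affine)
  then have "integrable lebesgue
      (\<lambda>x. indicator {a..b} x *\<^sub>R (indicator {l..r} (c + m * x) *\<^sub>R u (c + m * x)))"
    by (rule integrable_mult_indicator[rotated]) simp
  moreover have "c + m * x \<in> {l..r}" if "x \<in> {a..b}" for x
  proof (cases "m > 0")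
    case True
    then show ?thesis using that by (auto simp: l_def r_def min_le_iff_disj le_max_iff_disj)
  next
    case False
    then have "m * b \<le> m * x" "m * x \<le> m * a"
      using that by (auto intro: mult_left_mono_neg)
    then show ?thesis by (auto simp: l_def r_def)
  qed
  then have "(\<lambda>x. indicator {a..b} x *\<^sub>R (indicator {l..r} (c + m * x) *\<^sub>R u (c + m * x)))
      = (\<lambda>x. indicator {a..b} x *\<^sub>R u (c + m * x))"
    by (auto simp: fun_eq_iff indicator_def)
  ultimately show "(\<lambda>x. u (c + m * x)) absolutely_integrable_on {a..b}"
    by (simp add: set_integrable_def)
qed

lemma locally_integrable_measurable:
  assumes "locally_integrable u"
  shows "u \<in> borel_measurable lebesgue"
proof (rule borel_measurable_LIMSEQ_real)
  show "(\<lambda>n. indicator {- real n..real n} x *\<^sub>R u x) \<longlonglongrightarrow> u x" for x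
  proof (rule tendsto_eventually)
    have "\<forall>\<^sub>F n in sequentially. \<bar>x\<bar> \<le> real n"
      by (metis eventually_sequentiallyI nat_ceiling_le_eq)
    then show "\<forall>\<^sub>F n in sequentially. indicator {- real n..real n} x *\<^sub>R u x = u x"
      by eventually_elim (auto simp: indicator_def abs_le_iff)
  qed
  show "(\<lambda>x. indicator {- real n..real n} x *\<^sub>R u x) \<in> borel_measurable lebesgue" for n
    using assms unfolding locally_integrable_def set_integrable_def by blast
qed

text \<open>The product with a bounded kernel of compact support is dominated by \<open>K\<close>
  times a cutoff of \<open>v\<close>. Having both the Lebesgue integral over the line and the gauge
  integral over the support allows later arguments to switch between them.\<close>

lemma
  assumes v: "locally_integrable v" and k: "k \<in> borel_measurable borel"
    and K: "\<And>x. \<bar>k x\<bar> \<le> K" and k0: "\<And>x. x \<notin> {a..b} \<Longrightarrow> k x = 0"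
  shows locally_integrable_mult_integrable: "integrable lebesgue (\<lambda>x. v x * k x)"
    and locally_integrable_mult_LINT: "(LINT x|lebesgue. v x * k x) = integral {a..b} (\<lambda>x. v x * k x)"
    and locally_integrable_mult_integrable_on: "(\<lambda>x. v x * k x) integrable_on {a..b}"
proof -
  have [measurable]: "k \<in> borel_measurable lebesgue"
    using k by (simp add: measurable_completion)
  have [measurable]: "v \<in> borel_measurable lebesgue"
    using v by (rule locally_integrable_measurable)
  have "integrable lebesgue (\<lambda>x. K * (indicator {a..b} x *\<^sub>R v x))"
    using v by (simp add: locally_integrable_def set_integrable_def)
  then show int: "integrable lebesgue (\<lambda>x. v x * k x)"
  proof (rule Bochner_Integration.integrable_bound)
    have "\<bar>v x * k x\<bar> \<le> \<bar>K * (indicator {a..b} x * v x)\<bar>" for x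
    proof (cases "x \<in> {a..b}")
      case True
      have "\<bar>k x\<bar> \<le> \<bar>K\<bar>"
        using K[of x] by linarith
      then show ?thesis
        using True by (simp add: abs_mult mult.commute[of "\<bar>v x\<bar>"] mult_right_mono)
    qed (use k0 in auto)
    then show "AE x in lebesgue. norm (v x * k x) \<le> norm (K * (indicator {a..b} x *\<^sub>R v x))"
      by simp
  qed measurable
  have eq: "(\<lambda>x. indicator {a..b} x *\<^sub>R (v x * k x)) = (\<lambda>x. v x * k x)"
    using k0 by (auto simp: indicator_def fun_eq_iff)
  then have set: "set_integrable lebesgue {a..b} (\<lambda>x. v x * k x)"
    using int by (simp add: set_integrable_def)
  then show "(\<lambda>x. v x * k x) integrable_on {a..b}"
    by (rule set_lebesgue_integral_eq_integral)
  show "(LINT x|lebesgue. v x * k x) = integral {a..b} (\<lambda>x. v x * k x)"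
    using set_lebesgue_integral_eq_integral(2)[OF set] eq by (simp add: set_lebesgue_integral_def)
qed

section \<open>Lebesgue differentiation, precise representatives and mollification\<close>

lemma lebesgue_differentiation_right:
  assumes "locally_integrable u"
  obtains N where "negligible N"
    "\<And>x. x \<notin> N \<Longrightarrow> ((\<lambda>h. integral {x..x + h} u / h) \<longlongrightarrow> u x) (at_right 0)"
proof -
  \<comment> \<open>On the line, the cube with corner x and side h is the interval
    [x, x + h].\<close>
  obtain N where N: "negligible N"
    and lim: "\<And>x e. \<lbrakk>x \<notin> N; 0 < e\<rbrakk> \<Longrightarrow>
       \<exists>d>0. \<forall>h. 0 < h \<and> h < d \<longrightarrow> norm (integral (cbox x (x + h *\<^sub>R One)) u /\<^sub>R h ^ DIM(real) - u x) < e"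
  proof (rule integrable_ccontinuous_explicit[of u])
    show "u integrable_on cbox a b" for a b
      using locally_integrable_integrable_on[OF assms] by simp
  qed blast
  have "((\<lambda>h. integral {x..x + h} u / h) \<longlongrightarrow> u x) (at_right 0)" if "x \<notin> N" for x
    unfolding tendsto_iff
  proof (intro allI impI)
    fix e :: real assume "e > 0"
    then obtain d where "d > 0"
      and d: "\<forall>h. 0 < h \<and> h < d \<longrightarrow> norm (integral (cbox x (x + h *\<^sub>R One)) u /\<^sub>R h ^ DIM(real) - u x) < e"
      using lim \<open>x \<notin> N\<close> by blast
    then show "\<forall>\<^sub>F h in at_right 0. dist (integral {x..x + h} u / h) (u x) < e"
      unfolding eventually_at_right_field
      by (intro exI[of _ d]) (auto simp: dist_real_def divide_inverse mult.commute)
  qed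
  with N show thesis by (rule that)
qed

lemma lebesgue_point_right:
  assumes u: "locally_integrable u"
  obtains N where "negligible N"
    "\<And>x. x \<notin> N \<Longrightarrow> ((\<lambda>h. integral {x..x + h} (\<lambda>y. \<bar>u y - u x\<bar>) / h) \<longlongrightarrow> 0) (at_right 0)"
proof -
  have li: "locally_integrable (\<lambda>y. \<bar>u y - q\<bar>)" for q
    by (intro locally_integrable_abs locally_integrable_diff u locally_integrable_const)
  \<comment> \<open>Differentiate the integrals of \<open>\<bar>u - q\<bar>\<close> for all rational q at once, then choose q close to \<open>u x\<close>.\<close>
  define L where "L q x \<longleftrightarrow>
      ((\<lambda>h. integral {x..x + h} (\<lambda>y. \<bar>u y - q\<bar>) / h) \<longlongrightarrow> \<bar>u x - q\<bar>) (at_right 0)" for q x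
  have "\<exists>N. negligible N \<and> (\<forall>x. x \<notin> N \<longrightarrow> L q x)" for q
    using lebesgue_differentiation_right[OF li[of q]] unfolding L_def by blast
  then obtain N where N: "\<And>q. negligible (N q)" and lim: "\<And>q x. x \<notin> N q \<Longrightarrow> L q x"
    by metis
  have "((\<lambda>h. integral {x..x + h} (\<lambda>y. \<bar>u y - u x\<bar>) / h) \<longlongrightarrow> 0) (at_right 0)"
    if x: "x \<notin> (\<Union>q\<in>\<rat>. N q)" for x
    unfolding tendsto_iff
  proof (intro allI impI)
    fix e :: real assume "e > 0"
    \<comment> \<open>The margin \<open>e / 3\<close> is spent three times: on replacing
      \<open>u x\<close> by \<open>q\<close> inside the integral, on the convergence of the
      averages, and on their limit \<open>\<bar>u x - q\<bar>\<close>.\<close>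
    obtain q where "q \<in> \<rat>" and q: "u x < q" "q < u x + e / 3"
      using Rats_dense_in_real[of "u x" "u x + e / 3"] \<open>e > 0\<close> by auto
    then have "x \<notin> N q" using x by blast
    then have "\<forall>\<^sub>F h in at_right 0. dist (integral {x..x + h} (\<lambda>y. \<bar>u y - q\<bar>) / h) \<bar>u x - q\<bar> < e / 3"
      using lim \<open>e > 0\<close> unfolding L_def by (intro tendstoD) auto
    moreover have "\<forall>\<^sub>F h in at_right 0. (0::real) < h"
      by (simp add: eventually_at_right_less)
    ultimately show "\<forall>\<^sub>F h in at_right 0. dist (integral {x..x + h} (\<lambda>y. \<bar>u y - u x\<bar>) / h) 0 < e"
    proof eventually_elim
      case (elim h)
      have "integral {x..x + h} (\<lambda>y. \<bar>u y - u x\<bar>) \<le> integral {x..x + h} (\<lambda>y. \<bar>u y - q\<bar> + e / 3)"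
        using q by (intro integral_le integrable_add locally_integrable_integrable_on[OF li]) auto
      also have "\<dots> = integral {x..x + h} (\<lambda>y. \<bar>u y - q\<bar>) + h * (e / 3)"
        using elim by (subst integral_add) (auto intro: locally_integrable_integrable_on[OF li])
      finally have "integral {x..x + h} (\<lambda>y. \<bar>u y - u x\<bar>) / h
          \<le> integral {x..x + h} (\<lambda>y. \<bar>u y - q\<bar>) / h + e / 3"
        using elim by (simp add: field_simps)
      moreover have "integral {x..x + h} (\<lambda>y. \<bar>u y - u x\<bar>) / h \<ge> 0"
        using elim by (intro divide_nonneg_pos integral_nonneg locally_integrable_integrable_on[OF li]) auto
      ultimately show ?case
        using elim q unfolding dist_real_def by linarith
    qed
  qed
  moreover have "negligible (\<Union>q\<in>\<rat>. N q)"
    by (intro negligible_countable_Union) (auto simp: countable_rat N)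
  ultimately show thesis using that by blast
qed

lemma negligible_AE: "negligible N \<Longrightarrow> (\<And>x. x \<notin> N \<Longrightarrow> P x) \<Longrightarrow> AE x in lebesgue. P x"
  using AE_not_in[of N lebesgue] by (auto simp: negligible_iff_null_sets)

text \<open>A symmetric average is the mean of a right and a left average. The left averages of
  \<open>g\<close> are right averages of its reflection, so one-sided differentiation applied to
  both functions suffices; the second null set has to be reflected back.\<close>

lemma precise_rep_AE:
  assumes g: "locally_integrable g"
  shows "AE x in lebesgue. precise_rep g x = g x"
proof -
  obtain N1 where N1: "negligible N1"
    and lim1: "\<And>x. x \<notin> N1 \<Longrightarrow> ((\<lambda>h. integral {x..x + h} g / h) \<longlongrightarrow> g x) (at_right 0)"
    using lebesgue_differentiation_right[OF g] by metis
  have g': "locally_integrable (\<lambda>x. g (- x))"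
    using locally_integrable_affine[OF g, of "-1" 0] by simp
  obtain N2 where N2: "negligible N2"
    and lim2: "\<And>x. x \<notin> N2 \<Longrightarrow> ((\<lambda>h. integral {x..x + h} (\<lambda>x. g (- x)) / h) \<longlongrightarrow> g (- x)) (at_right 0)"
    using lebesgue_differentiation_right[OF g'] by metis
  have "precise_rep g x = g x" if x: "x \<notin> N1 \<union> uminus ` N2" for x
  proof -
    have "((\<lambda>h. integral {- x..- x + h} (\<lambda>x. g (- x)) / h) \<longlongrightarrow> g x) (at_right 0)"
      using lim2[of "- x"] x by force
    moreover have "integral {- x..- x + h} (\<lambda>x. g (- x)) = integral {x - h..x} g" for h
      using Henstock_Kurzweil_Integration.integral_reflect_real[of x "x - h" g] by (simp add: algebra_simps)
    ultimately have lim2: "((\<lambda>h. (integral {x..x + h} g / h + integral {x - h..x} g / h) / 2)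
        \<longlongrightarrow> (g x + g x) / 2) (at_right 0)"
      using lim1[of x] x by (intro tendsto_intros) auto
    have eq: "(integral {x..x + h} g / h + integral {x - h..x} g / h) / 2
        = (LINT y:{x - h..x + h}|lebesgue. g y) / (2 * h)" if "0 < h" for h
    proof -
      have "integral {x..x + h} g + integral {x - h..x} g = integral {x - h..x + h} g"
        using Henstock_Kurzweil_Integration.integral_combine[of "x - h" x "x + h" g] that
          locally_integrable_integrable_on[OF g] by simp
      then show ?thesis
        by (simp add: locally_integrable_LINT[OF g] add_divide_distrib[symmetric] mult.commute)
    qed
    have "\<forall>\<^sub>F h in at_right 0. (integral {x..x + h} g / h + integral {x - h..x} g / h) / 2
        = (LINT y:{x - h..x + h}|lebesgue. g y) / (2 * h)"
      by (rule eventually_mono[OF eventually_at_right_less eq])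
    then have "((\<lambda>r. (LINT y:{x - r..x + r}|lebesgue. g y) / (2 * r)) \<longlongrightarrow> (g x + g x) / 2) (at_right 0)"
      by (rule Lim_transform_eventually[OF lim2])
    then have lim: "((\<lambda>r. (LINT y:{x - r..x + r}|lebesgue. g y) / (2 * r)) \<longlongrightarrow> g x) (at_right 0)"
      by simp
    then show ?thesis
      unfolding precise_rep_def Let_def by (auto intro!: tendsto_Lim)
  qed
  moreover have "negligible (uminus ` N2)"
    using N2 by (intro negligible_differentiable_image_negligible)
      (auto intro!: derivative_intros)
  ultimately show ?thesis
    using N1 by (intro negligible_AE[of "N1 \<union> uminus ` N2"]) auto
qed

text \<open>The kernel lives on [c, c + h], has integral 1 because \<open>S\<close> rises from 0 to
  1, and is bounded by K/h. Hence the error is at most K times the average of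
  \<open>\<bar>u y - u c\<bar>\<close> over that interval, which tends to 0 at a Lebesgue
  point.\<close>

lemma mollification_tendsto:
  fixes s S :: "real \<Rightarrow> real"
  assumes u: "locally_integrable u"
    and S: "\<And>x. (S has_real_derivative s x) (at x)" and "S 0 = 0" "S 1 = 1"
    and s: "continuous_on UNIV s" and s0: "\<And>x. x \<notin> {0..1} \<Longrightarrow> s x = 0" and K: "\<And>x. \<bar>s x\<bar> \<le> K"
    and c: "((\<lambda>h. integral {c..c + h} (\<lambda>y. \<bar>u y - u c\<bar>) / h) \<longlongrightarrow> 0) (at_right 0)"
  shows "((\<lambda>h. LINT x|lebesgue. u x * (s ((x - c) / h) / h)) \<longlongrightarrow> u c) (at_right 0)"
proof -
  have "\<forall>\<^sub>F h in at_right 0. (0::real) < h"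
    by (simp add: eventually_at_right_less)
  then have "\<forall>\<^sub>F h in at_right 0. norm ((LINT x|lebesgue. u x * (s ((x - c) / h) / h)) - u c)
      \<le> integral {c..c + h} (\<lambda>y. \<bar>u y - u c\<bar>) / h * K"
  proof eventually_elim
    case (elim h)
    define k where "k x = s ((x - c) / h) / h" for x
    have k: "continuous_on UNIV k"
      unfolding k_def using elim by (auto intro!: continuous_intros continuous_on_compose2[OF s])
    then have kb: "k \<in> borel_measurable borel"
      by (rule borel_measurable_continuous_onI)
    have k0: "k x = 0" if "x \<notin> {c..c + h}" for x
      using s0[of "(x - c) / h"] elim that by (auto simp: k_def field_simps)
    have kK: "\<bar>k x\<bar> \<le> K / h" for x
      using K[of "(x - c) / h"] elim by (simp add: k_def divide_right_mono)
    have "((\<lambda>x. S ((x - c) / h)) has_real_derivative s ((x - c) / h) * (1 / h)) (at x)" for x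
      by (rule DERIV_chain2[OF S]) (use elim in \<open>auto intro!: derivative_eq_intros\<close>)
    then have "((\<lambda>x. S ((x - c) / h)) has_real_derivative k x) (at x)" for x
      by (simp add: k_def)
    then have "(k has_integral (S ((c + h - c) / h) - S ((c - c) / h))) {c..c + h}"
      using elim by (intro fundamental_theorem_of_calculus)
        (auto simp: has_real_derivative_iff_has_vector_derivative intro: has_vector_derivative_at_within)
    then have k1: "(k has_integral 1) {c..c + h}"
      using elim assms by simp
    have uk: "(LINT x|lebesgue. u x * k x) = integral {c..c + h} (\<lambda>x. u x * k x)"
      by (rule locally_integrable_mult_LINT[OF u kb kK k0])
    have "(LINT x|lebesgue. u x * k x) - u c
        = integral {c..c + h} (\<lambda>x. u x * k x) - integral {c..c + h} (\<lambda>x. u c * k x)"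
      using integral_unique[OF k1] unfolding uk by simp
    also have "\<dots> = integral {c..c + h} (\<lambda>x. (u x - u c) * k x)"
      using has_integral_integrable[OF k1] locally_integrable_mult_integrable_on[OF u kb kK k0]
      by (subst integral_diff[symmetric]) (auto simp: left_diff_distrib integrable_on_mult_right)
    also have "norm \<dots> \<le> integral {c..c + h} (\<lambda>x. \<bar>u x - u c\<bar> * (K / h))"
    proof (rule integral_norm_bound_integral)
      show "(\<lambda>x. (u x - u c) * k x) integrable_on {c..c + h}"
        by (rule locally_integrable_mult_integrable_on[OF _ kb kK k0])
          (auto intro: locally_integrable_diff u locally_integrable_const)
      show "(\<lambda>x. \<bar>u x - u c\<bar> * (K / h)) integrable_on {c..c + h}"
        by (intro integrable_on_mult_left locally_integrable_integrable_on locally_integrable_abs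
            locally_integrable_diff u locally_integrable_const)
    qed (auto simp: abs_mult simp del: times_divide_eq_right intro!: mult_left_mono kK)
    finally show ?case
      by (simp add: k_def)
  qed
  moreover have "((\<lambda>h. integral {c..c + h} (\<lambda>y. \<bar>u y - u c\<bar>) / h * K) \<longlongrightarrow> 0) (at_right 0)"
    by (rule tendsto_mult_left_zero[OF c])
  ultimately have "((\<lambda>h. (LINT x|lebesgue. u x * (s ((x - c) / h) / h)) - u c) \<longlongrightarrow> 0) (at_right 0)"
    by (rule Lim_null_comparison)
  then show ?thesis
    by (rule LIM_zero_cancel)
qed

subsection \<open>Primitives of weak derivatives\<close>

text \<open>Testing with a smoothed indicator of [a, b] turns the left side of the weak identity
  into a difference of mollifications of \<open>u\<close> at \<open>a\<close> and \<open>b\<close>,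
  with limit \<open>u a - u b\<close> at Lebesgue points. The right side tends to minus the integral
  of \<open>g\<close> by dominated convergence.\<close>

lemma has_weak_deriv_increment:
  assumes "has_weak_deriv u g"
  obtains N where "negligible N"
    "\<And>a b. a < b \<Longrightarrow> a \<notin> N \<Longrightarrow> b \<notin> N \<Longrightarrow> u b - u a = integral {a..b} g"
proof -
  have u: "locally_integrable u" and g: "locally_integrable g"
    and parts: "\<And>\<phi>. test_function \<phi> \<Longrightarrow>
      (LINT x|lebesgue. u x * deriv \<phi> x) = - (LINT x|lebesgue. g x * \<phi> x)"
    using assms by (auto simp: has_weak_deriv_def)
  obtain S s K where smooth_S: "smooth S" and dS: "\<And>x. (S has_real_derivative s x) (at x)"
    and s: "continuous_on UNIV s" and s0: "\<And>x. x \<notin> {0..1} \<Longrightarrow> s x = 0" and K: "\<And>x. \<bar>s x\<bar> \<le> K"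
    and S0: "\<And>x. x \<le> 0 \<Longrightarrow> S x = 0" and S1: "\<And>x. x \<ge> 1 \<Longrightarrow> S x = 1"
    and S_nonneg: "\<And>x. 0 \<le> S x" and S_le: "\<And>x. S x \<le> 1"
    by (rule smooth_step_exists) blast
  obtain N where N: "negligible N" and lim: "\<And>x. x \<notin> N \<Longrightarrow>
      ((\<lambda>h. integral {x..x + h} (\<lambda>y. \<bar>u y - u x\<bar>) / h) \<longlongrightarrow> 0) (at_right 0)"
    by (rule lebesgue_point_right[OF u]) blast
  define A where "A c h = (LINT x|lebesgue. u x * (s ((x - c) / h) / h))" for c h
  have A: "(A c \<longlongrightarrow> u c) (at_right 0)" if "c \<notin> N" for c
    unfolding A_def using mollification_tendsto[OF u dS S0 S1 s s0 K lim[OF that]] by simp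
  \<comment> \<open>Dominated convergence is applied to a sequence of scales. That they are at most
    1 keeps all supports inside [a, b + 1].\<close>
  define h where "h n = inverse (real (Suc n))" for n
  have h: "filterlim h (at_right 0) sequentially"
    unfolding h_def using LIMSEQ_inverse_real_of_nat
    by (auto simp: filterlim_at eventually_sequentially)
  have h_pos: "h n > 0" and h_le: "h n \<le> 1" for n
    by (auto simp: h_def field_simps)
  have "u b - u a = integral {a..b} g" if "a < b" "a \<notin> N" "b \<notin> N" for a b
  proof -
    \<comment> \<open>A test function that rises from 0 to 1 on \<open>[a, a + h n]\<close> and falls back to 0 on \<open>[b, b + h n]\<close>.\<close>
    define \<phi> where "\<phi> n x = S ((x - a) / h n) - S ((x - b) / h n)" for n x
    have k_facts: "(\<lambda>x. s ((x - c) / h n) / h n) \<in> borel_measurable borel"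
      "\<And>x. \<bar>s ((x - c) / h n) / h n\<bar> \<le> K / h n"
      "\<And>x. x \<notin> {c..c + h n} \<Longrightarrow> s ((x - c) / h n) / h n = 0" for c n
    proof -
      show "(\<lambda>x. s ((x - c) / h n) / h n) \<in> borel_measurable borel"
        using h_pos[of n]
        by (auto intro!: borel_measurable_continuous_onI continuous_intros continuous_on_compose2[OF s])
      show "\<bar>s ((x - c) / h n) / h n\<bar> \<le> K / h n" for x
        using K[of "(x - c) / h n"] h_pos[of n] by (simp add: divide_right_mono)
      show "s ((x - c) / h n) / h n = 0" if "x \<notin> {c..c + h n}" for x
        using s0[of "(x - c) / h n"] h_pos[of n] that by (auto simp: field_simps)
    qed
    have d\<phi>: "deriv (\<phi> n) x = s ((x - a) / h n) / h n - s ((x - b) / h n) / h n" for n x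
    proof (rule DERIV_imp_deriv)
      have "((\<lambda>x. S ((x - c) / h n)) has_real_derivative s ((x - c) / h n) * (1 / h n)) (at x)" for c
        by (rule DERIV_chain2[OF dS]) (use h_pos[of n] in \<open>auto intro!: derivative_eq_intros\<close>)
      then show "(\<phi> n has_real_derivative s ((x - a) / h n) / h n - s ((x - b) / h n) / h n) (at x)"
        unfolding \<phi>_def by (auto intro!: DERIV_diff)
    qed
    have \<phi>0: "\<phi> n x = 0" if "x \<notin> {a..b + 1}" for n x
    proof (cases "x < a")
      case True
      then have "(x - a) / h n \<le> 0" "(x - b) / h n \<le> 0"
        using h_pos[of n] \<open>a < b\<close> by (auto simp: divide_le_0_iff)
      then show ?thesis by (simp add: \<phi>_def S0)
    next
      case False
      then have "x - b \<ge> 1" using that by auto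
      then have "(x - a) / h n \<ge> 1" "(x - b) / h n \<ge> 1"
        using h_pos[of n] h_le[of n] \<open>a < b\<close> by (auto simp: field_simps)
      then show ?thesis by (simp add: \<phi>_def S1)
    qed
    have \<phi>1: "\<bar>\<phi> n x\<bar> \<le> 1" for n x
      using S_nonneg S_le by (smt (verit) \<phi>_def)
    have test: "test_function (\<phi> n)" for n
      unfolding test_function_def
    proof
      have "smooth (\<lambda>x. S ((1 / h n) * x + (- a / h n)) - S ((1 / h n) * x + (- b / h n)))"
        by (intro smooth_diff smooth_affine smooth_S)
      then have "smooth (\<phi> n)"
        by (simp add: \<phi>_def[abs_def] diff_divide_distrib)
      then show "\<forall>m. (deriv ^^ m) (\<phi> n) differentiable_on UNIV"
        by (simp add: smooth_def)
      have "{x. \<phi> n x \<noteq> 0} \<subseteq> {a..b + 1}"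
        using \<phi>0 by blast
      then show "compact (closure {x. \<phi> n x \<noteq> 0})"
        by (meson bounded_closed_interval bounded_subset compact_closure)
    qed
    have \<phi>_meas: "\<phi> n \<in> borel_measurable borel" for n
    proof -
      have "continuous_on UNIV S"
        using dS by (meson DERIV_isCont continuous_at_imp_continuous_on)
      then show ?thesis
        unfolding \<phi>_def[abs_def] using h_pos[of n]
        by (auto intro!: borel_measurable_continuous_onI continuous_intros
            continuous_on_compose2[of UNIV S])
    qed
    have "A a (h n) - A b (h n) = - (LINT x|lebesgue. g x * \<phi> n x)" for n
    proof -
      have "A a (h n) - A b (h n)
          = (LINT x|lebesgue. u x * (s ((x - a) / h n) / h n) - u x * (s ((x - b) / h n) / h n))"
        unfolding A_def
        by (intro Bochner_Integration.integral_diff[symmetric]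
            locally_integrable_mult_integrable[OF u k_facts])
      also have "\<dots> = (LINT x|lebesgue. u x * deriv (\<phi> n) x)"
        by (simp add: d\<phi> right_diff_distrib)
      finally show ?thesis
        using parts[OF test] by simp
    qed
    moreover have "(\<lambda>n. A a (h n) - A b (h n)) \<longlonglongrightarrow> u a - u b"
      using that by (intro tendsto_diff filterlim_compose[OF A h])
    moreover have "(\<lambda>n. - (LINT x|lebesgue. g x * \<phi> n x)) \<longlonglongrightarrow> - (LINT x|lebesgue. indicator {a..b} x *\<^sub>R g x)"
    proof (intro tendsto_minus integral_dominated_convergence)
      have g_int: "integrable lebesgue (\<lambda>x. indicator {p..q} x *\<^sub>R g x)" for p q
        using g by (simp add: locally_integrable_def set_integrable_def)
      show "integrable lebesgue (\<lambda>x. \<bar>indicator {a..b + 1} x *\<^sub>R g x\<bar>)"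
        by (intro integrable_abs g_int)
      show "(\<lambda>x. indicator {a..b} x *\<^sub>R g x) \<in> borel_measurable lebesgue"
        using g_int by (rule borel_measurable_integrable)
      show "(\<lambda>x. g x * \<phi> n x) \<in> borel_measurable lebesgue" for n
        using locally_integrable_mult_integrable[OF g \<phi>_meas \<phi>1 \<phi>0]
        by (rule borel_measurable_integrable)
      have "norm (g x * \<phi> n x) \<le> \<bar>indicator {a..b + 1} x *\<^sub>R g x\<bar>" for n x
        using \<phi>0[of x n] \<phi>1[of n x] mult_left_mono[OF \<phi>1[of n x], of "\<bar>g x\<bar>"]
        by (cases "x \<in> {a..b + 1}") (auto simp: abs_mult)
      then show "AE x in lebesgue. norm (g x * \<phi> n x) \<le> \<bar>indicator {a..b + 1} x *\<^sub>R g x\<bar>" for n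
        by simp
      have step: "(\<lambda>n. S ((x - c) / h n)) \<longlonglongrightarrow> (if x \<le> c then 0 else 1)" for x c
      proof (cases "x \<le> c")
        case True
        then have "S ((x - c) / h n) = 0" for n
          using h_pos[of n] by (intro S0) (simp add: divide_le_0_iff)
        then show ?thesis using True by simp
      next
        case False
        have "(h \<longlongrightarrow> 0) sequentially"
          using h by (simp add: filterlim_at)
        then have "\<forall>\<^sub>F n in sequentially. h n < x - c"
          using False by (intro order_tendstoD(2)) auto
        then have "\<forall>\<^sub>F n in sequentially. S ((x - c) / h n) = 1"
        proof eventually_elim
          case (elim n)
          then show ?case using h_pos[of n] by (intro S1) (simp add: field_simps)
        qed
        then show ?thesis using False by (simp add: tendsto_eventually)
      qed
      \<comment> \<open>The smoothed indicators converge to the indicator of the half-open interval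
        (a, b]; only the point \<open>a\<close> has to be excluded.\<close>
      have "(\<lambda>n. g x * \<phi> n x) \<longlonglongrightarrow> indicator {a..b} x *\<^sub>R g x" if "x \<noteq> a" for x
      proof -
        have "(\<lambda>n. g x * \<phi> n x) \<longlonglongrightarrow> g x * ((if x \<le> a then 0 else 1) - (if x \<le> b then 0 else 1))"
          unfolding \<phi>_def by (intro tendsto_mult tendsto_const tendsto_diff step)
        also have "g x * ((if x \<le> a then 0 else 1) - (if x \<le> b then 0 else 1)) = indicator {a..b} x *\<^sub>R g x"
          using that \<open>a < b\<close> by (auto simp: indicator_def)
        finally show ?thesis .
      qed
      then show "AE x in lebesgue. (\<lambda>n. g x * \<phi> n x) \<longlonglongrightarrow> indicator {a..b} x *\<^sub>R g x"
        using negligible_AE[OF negligible_sing[of a]] by simp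
    qed
    ultimately have "u a - u b = - (LINT x|lebesgue. indicator {a..b} x *\<^sub>R g x)"
      by (simp add: LIMSEQ_unique)
    also have "\<dots> = - integral {a..b} g"
      using locally_integrable_LINT[OF g] by (simp add: set_lebesgue_integral_def)
    finally show ?thesis by simp
  qed
  with N show thesis by (rule that)
qed

lemma primitive_exists:
  assumes g: "locally_integrable g"
  obtains F where "continuous_on UNIV F" "\<And>a b. a \<le> b \<Longrightarrow> F b - F a = integral {a..b} g"
proof -
  note gi = locally_integrable_integrable_on[OF g]
  have comb: "integral {a..c} g + integral {c..b} g = integral {a..b} g" if "a \<le> c" "c \<le> b" for a b c
    using Henstock_Kurzweil_Integration.integral_combine[OF that gi] .
  define F where "F x = (if 0 \<le> x then integral {0..x} g else - integral {x..0} g)" for x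
  have F: "F b - F a = integral {a..b} g" if "a \<le> b" for a b
    using comb[of 0 a b] comb[of a b 0] comb[of a 0 b] that by (auto simp: F_def)
  \<comment> \<open>Near x, \<open>F\<close> is a constant plus an indefinite integral from x - 1,
    which hides the case distinction at 0.\<close>
  have "continuous (at x) F" for x
  proof -
    have "continuous_on {x - 1..x + 1} (\<lambda>y. F (x - 1) + integral {x - 1..y} g)"
      by (intro continuous_intros indefinite_integral_continuous_1 gi)
    then have "continuous_on {x - 1..x + 1} F"
      by (rule continuous_on_eq) (use F[of "x - 1"] in force)
    then show ?thesis
      by (rule continuous_on_interior) simp
  qed
  then have "continuous_on UNIV F"
    by (simp add: continuous_at_imp_continuous_on)
  with F show thesis using that by blast
qed

text \<open>Outside a null set the increments of \<open>u\<close> are those of any primitive of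
  \<open>g\<close>. Shifting a primitive to match \<open>u\<close> at one point outside that set
  gives the continuous representative.\<close>

lemma has_weak_deriv_primitive:
  assumes "has_weak_deriv u g"
  obtains F where "continuous_on UNIV F" "AE x in lebesgue. u x = F x"
    "\<And>a b. a \<le> b \<Longrightarrow> F b - F a = integral {a..b} g"
proof -
  obtain N where N: "negligible N"
    and inc: "\<And>a b. a < b \<Longrightarrow> a \<notin> N \<Longrightarrow> b \<notin> N \<Longrightarrow> u b - u a = integral {a..b} g"
    by (rule has_weak_deriv_increment[OF assms]) blast
  have "locally_integrable g"
    using assms by (simp add: has_weak_deriv_def)
  then obtain F where F: "continuous_on UNIV F" "\<And>a b. a \<le> b \<Longrightarrow> F b - F a = integral {a..b} g"
    by (rule primitive_exists) blast
  obtain x0 where x0: "x0 \<notin> N"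
    using N non_negligible_UNIV by (metis UNIV_eq_I)
  show thesis
  proof (rule that[of "\<lambda>x. F x + (u x0 - F x0)"])
    have "u x = F x + (u x0 - F x0)" if "x \<notin> N" for x
      using inc[of x x0] inc[of x0 x] F(2)[of x x0] F(2)[of x0 x] that x0
      by (cases x x0 rule: linorder_cases) auto
    with N show "AE x in lebesgue. u x = F x + (u x0 - F x0)"
      by (rule negligible_AE)
    show "continuous_on UNIV (\<lambda>x. F x + (u x0 - F x0))"
      by (intro continuous_intros F)
  qed (use F in auto)
qed

text \<open>The inequality fails on an open set, and a nonempty open set is not null.\<close>

lemma AE_continuous_le:
  fixes F G :: "real \<Rightarrow> real"
  assumes "AE x in lebesgue. F x \<le> G x" "continuous_on UNIV F" "continuous_on UNIV G"
  shows "F x \<le> G x"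
proof (rule ccontr)
  assume "\<not> F x \<le> G x"
  then have "x \<in> {y. G y < F y}" by simp
  have "open {y. G y < F y}"
    using assms(2,3) by (intro open_Collect_less)
  then have "\<not> negligible {y. G y < F y}"
    by (rule open_not_negligible) (use \<open>x \<in> _\<close> in blast)
  have "{y. G y < F y} \<in> sets lebesgue"
    using \<open>open {y. G y < F y}\<close> by simp
  then have "{y. G y < F y} \<in> null_sets lebesgue"
    using assms(1) by (simp only: AE_iff_null_sets mem_Collect_eq not_less)
  with \<open>\<not> negligible {y. G y < F y}\<close> show False
    by (simp add: negligible_iff_null_sets)
qed

text \<open>The primitives of both weak derivatives represent \<open>u\<close>. Being continuous and
  equal almost everywhere, they coincide, and so do their increments.\<close>

lemma has_weak_deriv_integral_unique:
  assumes "has_weak_deriv u g1" "has_weak_deriv u g2"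
  shows "integral {a..b} g1 = integral {a..b} g2"
proof (cases "a \<le> b")
  case True
  obtain F1 where F1: "continuous_on UNIV F1" "AE x in lebesgue. u x = F1 x"
    "\<And>a b. a \<le> b \<Longrightarrow> F1 b - F1 a = integral {a..b} g1"
    by (rule has_weak_deriv_primitive[OF assms(1)]) blast
  obtain F2 where F2: "continuous_on UNIV F2" "AE x in lebesgue. u x = F2 x"
    "\<And>a b. a \<le> b \<Longrightarrow> F2 b - F2 a = integral {a..b} g2"
    by (rule has_weak_deriv_primitive[OF assms(2)]) blast
  have "AE x in lebesgue. F1 x \<le> F2 x" "AE x in lebesgue. F2 x \<le> F1 x"
    using F1(2) F2(2) by (eventually_elim, simp)+
  then have "F1 x = F2 x" for x
    using AE_continuous_le F1(1) F2(1) by (intro antisym)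
  then show ?thesis
    using F1(3)[OF True] F2(3)[OF True] by simp
qed simp

section \<open>Independence of \<open>wderiv\<close> from the chosen weak derivative\<close>

lemma has_weak_deriv_locally_integrable:
  assumes "has_weak_deriv u g"
  shows "locally_integrable u" "locally_integrable g"
  using assms by (simp_all add: has_weak_deriv_def)

text \<open>\<open>precise_rep\<close> sees its argument only through integrals over intervals, and
  these are the same for all weak derivatives of \<open>u\<close>. Any witness may thus stand in for
  the one picked by \<open>SOME\<close>.\<close>

lemma wderiv_eq:
  assumes "has_weak_deriv u g"
  shows "wderiv u = precise_rep g"
proof -
  define g' where "g' = (SOME g. has_weak_deriv u g)"
  have g': "has_weak_deriv u g'"
    unfolding g'_def using assms by (rule someI[of "has_weak_deriv u"])
  have "(LINT y:{a..b}|lebesgue. g' y) = (LINT y:{a..b}|lebesgue. g y)" for a b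
    using has_weak_deriv_integral_unique[OF g' assms]
    by (simp add: locally_integrable_LINT has_weak_deriv_locally_integrable(2)[OF g']
        has_weak_deriv_locally_integrable(2)[OF assms])
  then have "precise_rep g' = precise_rep g"
    by (simp add: precise_rep_def[abs_def])
  then show ?thesis
    by (simp add: wderiv_def g'_def)
qed

lemma wderiv_AE:
  assumes "has_weak_deriv u g"
  shows "AE x in lebesgue. wderiv u x = g x"
  unfolding wderiv_eq[OF assms]
  by (rule precise_rep_AE[OF has_weak_deriv_locally_integrable(2)[OF assms]])

lemma wderiv_measurable:
  assumes "has_weak_deriv u g"
  shows "wderiv u \<in> borel_measurable lebesgue"
proof (rule borel_measurable_AE)
  show "g \<in> borel_measurable lebesgue"
    by (rule locally_integrable_measurable[OF has_weak_deriv_locally_integrable(2)[OF assms]])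
  show "AE x in lebesgue. g x = wderiv u x"
    using wderiv_AE[OF assms] by eventually_elim simp
qed

subsection \<open>Pointwise bounds and translations\<close>

lemma AE_lebesgue_imp_ex:
  assumes "AE x in lebesgue. P (x::real)"
  shows "\<exists>x. P x"
proof (rule ccontr)
  assume "\<nexists>x. P x"
  with assms have "AE x in lebesgue. x \<notin> (UNIV :: real set)" by simp
  then have "negligible (UNIV :: real set)"
    by (subst negligible_iff_null_sets, subst AE_iff_null_sets) auto
  then show False by simp
qed

text \<open>If \<open>h\<close> is not integrable, its integral is 0 by convention, which is within
  the bound as \<open>M\<close> is nonnegative. The estimate can thus be applied along a line of the
  plane without a separate proof of integrability there.\<close>

lemma set_lebesgue_integral_bound_AE:
  fixes h :: "real \<Rightarrow> real"
  assumes "AE x in lebesgue. x \<in> {a..b} \<longrightarrow> \<bar>h x\<bar> \<le> M" "a \<le> b" "0 \<le> M"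
  shows "\<bar>LINT x:{a..b}|lebesgue. h x\<bar> \<le> M * (b - a)"
proof (cases "set_integrable lebesgue {a..b} h")
  case True
  have "\<bar>LINT x:{a..b}|lebesgue. h x\<bar> \<le> (LINT x|lebesgue. norm (indicator {a..b} x *\<^sub>R h x))"
    unfolding set_lebesgue_integral_def real_norm_def[symmetric] by (rule integral_norm_bound)
  also have "\<dots> \<le> (LINT x|lebesgue. M * indicator {a..b} x)"
  proof (rule integral_mono_AE)
    show "integrable lebesgue (\<lambda>x. norm (indicator {a..b} x *\<^sub>R h x))"
      using True unfolding set_integrable_def by (rule integrable_norm)
    show "integrable lebesgue (\<lambda>x. M * indicator {a..b} x)"
      by (intro integrable_mult_right integrable_real_indicator) (use assms(2) in simp_all)
    show "AE x in lebesgue. norm (indicator {a..b} x *\<^sub>R h x) \<le> M * indicator {a..b} x"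
      using assms(1) by eventually_elim (auto simp: indicator_def)
  qed
  also have "\<dots> = M * (b - a)"
    using assms(2) by simp
  finally show ?thesis .
next
  case False
  then show ?thesis
    using assms by (simp add: set_integrable_def set_lebesgue_integral_def not_integrable_integral_eq)
qed

lemma precise_rep_bound:
  assumes "AE x in lebesgue. \<bar>g x\<bar> \<le> M"
  shows "\<bar>precise_rep g x\<bar> \<le> M"
proof -
  \<comment> \<open>This also covers points where the averages have no limit and
    \<open>precise_rep\<close> takes its default value 0.\<close>
  have M: "0 \<le> M"
    using AE_lebesgue_imp_ex[OF assms] by force
  define avg where "avg r = (LINT y:{x - r..x + r}|lebesgue. g y) / (2 * r)" for r
  have bound: "\<bar>avg r\<bar> \<le> M" if "r > 0" for r
  proof -
    have "AE y in lebesgue. y \<in> {x - r..x + r} \<longrightarrow> \<bar>g y\<bar> \<le> M"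
      using assms by eventually_elim simp
    then have "\<bar>LINT y:{x - r..x + r}|lebesgue. g y\<bar> \<le> M * ((x + r) - (x - r))"
      using that M by (intro set_lebesgue_integral_bound_AE) auto
    then show ?thesis
      using that by (simp add: avg_def divide_le_eq)
  qed
  have "\<bar>l\<bar> \<le> M" if "(avg \<longlongrightarrow> l) (at_right 0)" for l
  proof (rule tendsto_upperbound[OF tendsto_rabs[OF that]])
    show "\<forall>\<^sub>F r in at_right 0. \<bar>avg r\<bar> \<le> M"
      using eventually_at_right_less by (rule eventually_mono) (rule bound)
  qed simp
  moreover have "Lim (at_right 0) avg = l" if "(avg \<longlongrightarrow> l) (at_right 0)" for l
    using that by (intro tendsto_Lim) auto
  ultimately show ?thesis
    using M by (auto simp: precise_rep_def avg_def[abs_def, symmetric])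
qed

text \<open>
  Symmetric averages inherit an almost everywhere bound, so the precise representative satisfies
  it at every point. This is what allows integrating along single lines of the plane.
\<close>

lemma wderiv_bound:
  assumes u: "has_weak_deriv u g" and AE: "AE x in lebesgue. ereal \<bar>wderiv u x\<bar> \<le> E"
  shows "ereal \<bar>wderiv u x\<bar> \<le> E"
proof (cases E)
  case (real M)
  have "AE x in lebesgue. \<bar>g x\<bar> \<le> M"
    using wderiv_AE[OF u] AE by eventually_elim (simp add: real)
  then show ?thesis
    using precise_rep_bound[of g M x] by (simp add: wderiv_eq[OF u] real)
next
  case MInf
  then show ?thesis
    using AE_lebesgue_imp_ex[OF AE] by simp
qed simp

section \<open>Invariance under translations\<close>

lemma LINT_translate:
  fixes F :: "real \<Rightarrow> real"
  shows "(LINT x|lebesgue. F (x + c)) = (LINT x|lebesgue. F x)"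
  using lebesgue_integral_real_affine[of 1 F c] by (simp add: add.commute)

text \<open>A change of variables moves the shift onto the test function, and a shifted test
  function is again a test function.\<close>

lemma has_weak_deriv_translate:
  assumes "has_weak_deriv u g"
  shows "has_weak_deriv (\<lambda>x. u (x - c)) (\<lambda>x. g (x - c))"
proof -
  have li: "locally_integrable (\<lambda>x. u (x - c))" "locally_integrable (\<lambda>x. g (x - c))"
    using locally_integrable_affine[of u 1 "- c"] locally_integrable_affine[of g 1 "- c"]
      has_weak_deriv_locally_integrable[OF assms] by simp_all
  have "(LINT x|lebesgue. u (x - c) * deriv \<phi> x) = - (LINT x|lebesgue. g (x - c) * \<phi> x)"
    if \<phi>: "test_function \<phi>" for \<phi>
  proof -
    have smooth: "smooth \<phi>" and "compact (closure {x. \<phi> x \<noteq> 0})"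
      using \<phi> by (simp_all add: test_function_def smooth_def)
    have "{x. \<phi> (x + c) \<noteq> 0} = (\<lambda>x. - c + x) ` {x. \<phi> x \<noteq> 0}"
    proof (intro set_eqI iffI)
      fix x assume "x \<in> {x. \<phi> (x + c) \<noteq> 0}"
      then show "x \<in> (\<lambda>x. - c + x) ` {x. \<phi> x \<noteq> 0}"
        by (intro image_eqI[of _ _ "x + c"]) auto
    qed auto
    then have "compact (closure {x. \<phi> (x + c) \<noteq> 0})"
      using \<open>compact (closure {x. \<phi> x \<noteq> 0})\<close> by (simp only: compact_closure bounded_translation)
    moreover have "smooth (\<lambda>x. \<phi> (x + c))"
      using smooth_affine[OF smooth, of 1 c] by simp
    ultimately have test: "test_function (\<lambda>x. \<phi> (x + c))"
      by (simp add: test_function_def smooth_def)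
    have "deriv (\<lambda>x. \<phi> (x + c)) x = deriv \<phi> (x + c)" for x
      by (rule DERIV_imp_deriv)
        (use smooth_has_derivative[OF smooth, of "x + c"] in \<open>simp add: DERIV_shift\<close>)
    moreover have "(LINT x|lebesgue. u x * deriv (\<lambda>x. \<phi> (x + c)) x) = - (LINT x|lebesgue. g x * \<phi> (x + c))"
      using assms test unfolding has_weak_deriv_def by blast
    ultimately have "(LINT x|lebesgue. u x * deriv \<phi> (x + c)) = - (LINT x|lebesgue. g x * \<phi> (x + c))"
      by simp
    then show ?thesis
      using LINT_translate[of "\<lambda>x. u (x - c) * deriv \<phi> x" c] LINT_translate[of "\<lambda>x. g (x - c) * \<phi> x" c]
      by simp
  qed
  with li show ?thesis
    by (simp add: has_weak_deriv_def)
qed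

lemma precise_rep_translate: "precise_rep (\<lambda>x. g (x - c)) x = precise_rep g (x - c)"
proof -
  have "(LINT y:{x - r..x + r}|lebesgue. g (y - c)) = (LINT y:{x - c - r..x - c + r}|lebesgue. g y)" for r
  proof -
    have "indicator {x - r..x + r} (y + c) = (indicator {x - c - r..x - c + r} y :: real)" for y
      by (auto simp: indicator_def)
    then show ?thesis
      unfolding set_lebesgue_integral_def
      using LINT_translate[of "\<lambda>y. indicator {x - r..x + r} y *\<^sub>R g (y - c)" c] by simp
  qed
  then show ?thesis
    by (simp add: precise_rep_def)
qed

lemma wderiv_translate:
  assumes "has_weak_deriv u g"
  shows "wderiv (\<lambda>x. u (x - c)) x = wderiv u (x - c)"
  by (simp add: wderiv_eq[OF assms] wderiv_eq[OF has_weak_deriv_translate[OF assms]] precise_rep_translate)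

section \<open>From the half-plane to single times, and the general bound\<close>

lemma AE_half_plane_imp:
  assumes "AE p in half_plane. P p"
  shows "AE t in lebesgue. t \<ge> 0 \<longrightarrow> (AE x in lebesgue. P (t, x))"
proof -
  have "closed ({0..} \<times> (UNIV :: real set) :: (real \<times> real) set)"
    by (intro closed_Times) auto
  then have "AE p in lebesgue. p \<in> {0..} \<times> UNIV \<longrightarrow> P p"
    using assms by (subst (asm) AE_restrict_space_iff) auto
  \<comment> \<open>Lebesgue measure of the plane is the completion of the product measure, so the
    Fubini argument for null sets runs in \<open>lborel\<close>.\<close>
  then have "AE p in lborel \<Otimes>\<^sub>M lborel. p \<in> {0..} \<times> UNIV \<longrightarrow> P p"
    by (simp only: AE_completion_iff lborel_prod)
  then have "AE t in lborel. AE x in lborel. (t, x) \<in> {0..} \<times> UNIV \<longrightarrow> P (t, x)"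
    by (rule lborel_pair.AE_pair)
  then show ?thesis
    by (simp add: AE_completion_iff)
qed

lemma AE_nonneg_imp_ex:
  assumes "AE t in lebesgue. t \<ge> 0 \<longrightarrow> P (t::real)"
  shows "\<exists>t\<ge>0. P t"
proof (rule ccontr)
  assume "\<not> (\<exists>t\<ge>0. P t)"
  with assms have "AE t in lebesgue. t \<notin> {0..1::real}"
    by (auto elim!: eventually_mono)
  then have "negligible {0..1::real}"
    by (subst negligible_iff_null_sets, subst AE_iff_null_sets) auto
  then show False
    using negligible_interval(1)[of 0 "1::real"] by simp
qed

lemma Linf_norm_AE: "AE x in M. ereal \<bar>g x\<bar> \<le> Linf_norm M g"
  unfolding Linf_norm_def by (rule esssup_AE)

text \<open>Measurability enters because \<open>esssup\<close> of a non-measurable function is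
  \<open>top\<close>.\<close>

lemma Linf_norm_leI:
  assumes "g \<in> borel_measurable M" "AE x in M. ereal \<bar>g x\<bar> \<le> E"
  shows "Linf_norm M g \<le> E"
  unfolding Linf_norm_def by (rule esssup_I) (use assms in auto)

text \<open>Fubini gives the bound for almost every x at almost every time, and
  \<open>wderiv_bound\<close> extends it to every x. The exceptional set now consists of times only,
  so every line of integration meets it in a null set.\<close>

lemma in_Linf_H1_dX_bound:
  assumes "in_Linf_H1 f"
  shows "AE t in lebesgue. t \<ge> 0 \<longrightarrow> (\<forall>x. ereal \<bar>dX f (t, x)\<bar> \<le> Linf_norm half_plane (dX f))"
proof -
  have "AE t in lebesgue. t \<in> {0..} \<longrightarrow> in_H1 (f t)"
    using assms by (simp add: in_Linf_H1_def AE_restrict_space_iff)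
  moreover have "AE t in lebesgue. t \<ge> 0 \<longrightarrow>
      (AE x in lebesgue. ereal \<bar>dX f (t, x)\<bar> \<le> Linf_norm half_plane (dX f))"
    by (rule AE_half_plane_imp[OF Linf_norm_AE])
  ultimately show ?thesis
  proof eventually_elim
    case (elim t)
    show ?case
    proof (intro impI allI)
      fix x assume "t \<ge> 0"
      with elim(1) have "in_H1 (f t)" by simp
      then obtain g where g: "has_weak_deriv (f t) g"
        unfolding in_H1_def by blast
      have dX: "dX f (t, x) = wderiv (f t) x" for x
        by (simp add: dX_def)
      from elim(2) \<open>t \<ge> 0\<close> show "ereal \<bar>dX f (t, x)\<bar> \<le> Linf_norm half_plane (dX f)"
        unfolding dX by (intro wderiv_bound[OF g]) blast
    qed
  qed
qed

lemma h_R_bound: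
  assumes "in_Linf_H1 f" "in_Linf half_plane (dX f)" "t > 0"
  shows "ereal \<bar>h_R f t X\<bar> \<le> ereal (t / 2) * Linf_norm half_plane (dX f)"
proof -
  note AE = in_Linf_H1_dX_bound[OF assms(1)]
  \<comment> \<open>A single time at which the bound holds shows that the norm is nonnegative, hence
    a real number by finiteness.\<close>
  obtain t0 where "\<forall>x. ereal \<bar>dX f (t0, x)\<bar> \<le> Linf_norm half_plane (dX f)"
    using AE_nonneg_imp_ex[OF AE] by blast
  then have "ereal 0 \<le> Linf_norm half_plane (dX f)"
    by (metis abs_ge_zero ereal_less_eq(3) order_trans)
  moreover have "Linf_norm half_plane (dX f) < \<infinity>"
    using assms(2) by (simp add: in_Linf_def)
  ultimately obtain M where M: "Linf_norm half_plane (dX f) = ereal M" "M \<ge> 0"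
    by (cases "Linf_norm half_plane (dX f)") auto
  have "AE \<tau> in lebesgue. \<tau> \<in> {0..t} \<longrightarrow> \<bar>dX f (\<tau>, X - t + \<tau>)\<bar> \<le> M"
    using AE by eventually_elim (auto simp: M)
  then have "\<bar>LINT \<tau>:{0..t}|lebesgue. dX f (\<tau>, X - t + \<tau>)\<bar> \<le> M * (t - 0)"
    using assms(3) M by (intro set_lebesgue_integral_bound_AE) auto
  then show ?thesis
    by (simp add: h_R_def M abs_mult mult.commute)
qed

subsection \<open>Travelling disturbances\<close>

context
  fixes f :: "real \<Rightarrow> real \<Rightarrow> real" and f\<^sub>0 g :: "real \<Rightarrow> real" and U :: real
  assumes f\<^sub>0: "has_weak_deriv f\<^sub>0 g"
    and travelling: "\<And>t X. t \<ge> 0 \<Longrightarrow> f t X = f\<^sub>0 (X - U * t)"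
begin

lemma travelling_dX:
  assumes "t \<ge> 0"
  shows "dX f (t, x) = wderiv f\<^sub>0 (x - U * t)"
proof -
  have "f t = (\<lambda>x. f\<^sub>0 (x - U * t))"
    using travelling[OF assms] by auto
  then show ?thesis
    by (simp add: dX_def wderiv_translate[OF f\<^sub>0])
qed

text \<open>Every value of \<open>dX f\<close> in the half-plane is a value of
  \<open>wderiv f\<^sub>0\<close>, which is bounded pointwise. Conversely, almost every time slice
  inherits the bound of the half-plane and is a translate of the whole profile, so one slice
  suffices.\<close>

lemma travelling_Linf_norm:
  assumes "in_Linf half_plane (dX f)"
  shows "Linf_norm half_plane (dX f) = Linf_norm lebesgue (wderiv f\<^sub>0)"
proof (rule antisym)
  show "Linf_norm half_plane (dX f) \<le> Linf_norm lebesgue (wderiv f\<^sub>0)"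
  proof (rule Linf_norm_leI)
    have "ereal \<bar>dX f p\<bar> \<le> Linf_norm lebesgue (wderiv f\<^sub>0)" if "p \<in> space half_plane" for p
      using that travelling_dX[of "fst p" "snd p"] wderiv_bound[OF f\<^sub>0 Linf_norm_AE]
      by (auto simp: space_restrict_space)
    then show "AE p in half_plane. ereal \<bar>dX f p\<bar> \<le> Linf_norm lebesgue (wderiv f\<^sub>0)"
      by (rule AE_I2)
  qed (use assms in \<open>simp add: in_Linf_def\<close>)
  show "Linf_norm lebesgue (wderiv f\<^sub>0) \<le> Linf_norm half_plane (dX f)"
  proof (rule Linf_norm_leI[OF wderiv_measurable[OF f\<^sub>0]])
    obtain t where "t \<ge> 0" and
      "AE x in lebesgue. ereal \<bar>dX f (t, x)\<bar> \<le> Linf_norm half_plane (dX f)"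
      using AE_nonneg_imp_ex[OF AE_half_plane_imp[OF Linf_norm_AE]] by blast
    then have "AE x in lebesgue. ereal \<bar>wderiv (\<lambda>x. f\<^sub>0 (x - U * t)) x\<bar> \<le> Linf_norm half_plane (dX f)"
      by (simp add: travelling_dX wderiv_translate[OF f\<^sub>0])
    then have "ereal \<bar>wderiv (\<lambda>x. f\<^sub>0 (x - U * t)) (y + U * t)\<bar> \<le> Linf_norm half_plane (dX f)" for y
      by (rule wderiv_bound[OF has_weak_deriv_translate[OF f\<^sub>0]])
    then show "AE y in lebesgue. ereal \<bar>wderiv f\<^sub>0 y\<bar> \<le> Linf_norm half_plane (dX f)"
      by (simp add: wderiv_translate[OF f\<^sub>0])
  qed
qed

lemma travelling_h_R:
  assumes "t \<ge> 0"
  shows "h_R f t X = 1 / 2 * (LINT \<tau>:{0..t}|lebesgue. wderiv f\<^sub>0 (X - t + (1 - U) * \<tau>))"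
proof -
  have "(LINT \<tau>:{0..t}|lebesgue. dX f (\<tau>, X - t + \<tau>))
      = (LINT \<tau>:{0..t}|lebesgue. wderiv f\<^sub>0 (X - t + (1 - U) * \<tau>))"
    by (rule set_lebesgue_integral_cong) (auto simp: travelling_dX algebra_simps)
  then show ?thesis
    by (simp add: h_R_def)
qed

lemma travelling_h_R_primitive:
  assumes F: "\<And>a b. a \<le> b \<Longrightarrow> F b - F a = integral {a..b} g" and "U \<noteq> 1" "t \<ge> 0"
  shows "h_R f t X = (F (X - U * t) - F (X - t)) / (2 * (1 - U))"
proof -
  define y m where "y = X - t" and "m = 1 - U"
  have m: "m \<noteq> 0" using assms by (simp add: m_def)
  \<comment> \<open>\<open>F\<close> is a primitive of \<open>g\<close>, while \<open>h_R\<close>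
    involves \<open>wderiv f\<^sub>0\<close>; the two agree almost everywhere and have equal
    integrals.\<close>
  have wg: "(LINT x:{a..b}|lebesgue. wderiv f\<^sub>0 x) = integral {a..b} g" for a b
  proof -
    have "(LINT x:{a..b}|lebesgue. wderiv f\<^sub>0 x) = (LINT x:{a..b}|lebesgue. g x)"
    proof (rule set_lebesgue_integral_cong_AE)
      show "AE x \<in> {a..b} in lebesgue. wderiv f\<^sub>0 x = g x"
        using wderiv_AE[OF f\<^sub>0] by eventually_elim simp
    qed (auto intro: wderiv_measurable[OF f\<^sub>0] locally_integrable_measurable
        has_weak_deriv_locally_integrable(2)[OF f\<^sub>0])
    then show ?thesis
      by (simp add: locally_integrable_LINT has_weak_deriv_locally_integrable(2)[OF f\<^sub>0])
  qed
  \<comment> \<open>The image of [0, t] under the substitution x = y + m * \<tau>. For negative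
    \<open>m\<close> it is traversed backwards, which accounts for the sign of the increment of
    \<open>F\<close> below.\<close>
  define I where "I = (if m > 0 then {y..y + m * t} else {y + m * t..y})"
  have "indicator I (y + m * \<tau>) = (indicator {0..t} \<tau> :: real)" for \<tau>
    using m by (auto simp: I_def indicator_def zero_le_mult_iff mult_le_0_iff)
  then have "(LINT x:I|lebesgue. wderiv f\<^sub>0 x) = \<bar>m\<bar> * (LINT \<tau>:{0..t}|lebesgue. wderiv f\<^sub>0 (y + m * \<tau>))"
    unfolding set_lebesgue_integral_def
    using lebesgue_integral_real_affine[OF m, of "\<lambda>x. indicator I x *\<^sub>R wderiv f\<^sub>0 x" y] by simp
  moreover have "(LINT x:I|lebesgue. wderiv f\<^sub>0 x) = (if m > 0 then 1 else - 1) * (F (y + m * t) - F y)"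
    using assms(3) m F[of y "y + m * t"] F[of "y + m * t" y]
    by (auto simp: I_def wg mult_le_0_iff)
  ultimately have "(LINT \<tau>:{0..t}|lebesgue. wderiv f\<^sub>0 (y + m * \<tau>)) = (F (y + m * t) - F y) / m"
    using m by (auto simp: field_simps split: if_splits)
  moreover have "y + m * t = X - U * t"
    by (simp add: y_def m_def algebra_simps)
  moreover have "h_R f t X = 1 / 2 * (LINT \<tau>:{0..t}|lebesgue. wderiv f\<^sub>0 (y + m * \<tau>))"
    unfolding y_def m_def by (rule travelling_h_R[OF assms(3)])
  ultimately have "h_R f t X = (F (X - U * t) - F y) / (2 * m)"
    by simp
  then show ?thesis
    by (simp only: y_def m_def)
qed

text \<open>The second bound is the general one rewritten through the profile. The first bounds the
  two values of \<open>F\<close> in the formula for \<open>h_R\<close> by the norm of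
  \<open>f\<^sub>0\<close> each, and the resulting factor 2 cancels against the denominator.\<close>

lemma travelling_Linf_norm_h_R:
  assumes f: "in_Linf_H1 f" "in_Linf half_plane (dX f)" and "U \<noteq> 1" "t > 0"
  shows "Linf_norm lebesgue (h_R f t) \<le> min (Linf_norm lebesgue f\<^sub>0 / ereal \<bar>1 - U\<bar>)
    (ereal (t / 2) * Linf_norm lebesgue (wderiv f\<^sub>0))"
proof -
  obtain F where F: "continuous_on UNIV F" "AE x in lebesgue. f\<^sub>0 x = F x"
    "\<And>a b. a \<le> b \<Longrightarrow> F b - F a = integral {a..b} g"
    by (rule has_weak_deriv_primitive[OF f\<^sub>0]) blast
  have h_R: "h_R f t X = (F (X - U * t) - F (X - t)) / (2 * (1 - U))" for X
    using F(3) assms by (intro travelling_h_R_primitive) auto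
  have "continuous_on UNIV (\<lambda>X. (F (X - U * t) - F (X - t)) / (2 * (1 - U)))"
    using assms by (auto intro!: continuous_intros continuous_on_compose2[OF F(1)])
  then have "(\<lambda>X. (F (X - U * t) - F (X - t)) / (2 * (1 - U))) \<in> borel_measurable lebesgue"
    by (simp add: borel_measurable_continuous_onI measurable_completion)
  then have meas: "h_R f t \<in> borel_measurable lebesgue"
    by (simp add: h_R[abs_def])
  have "Linf_norm lebesgue (h_R f t) \<le> ereal (t / 2) * Linf_norm lebesgue (wderiv f\<^sub>0)"
    using h_R_bound[OF f \<open>t > 0\<close>] by (intro Linf_norm_leI[OF meas]) (simp add: travelling_Linf_norm[OF f(2)])
  moreover have "Linf_norm lebesgue (h_R f t) \<le> Linf_norm lebesgue f\<^sub>0 / ereal \<bar>1 - U\<bar>"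
  proof (cases "Linf_norm lebesgue f\<^sub>0")
    case (real B)
    \<comment> \<open>The essential bound on \<open>f\<^sub>0\<close> passes to \<open>F\<close>
      almost everywhere and, by continuity, everywhere.\<close>
    have "AE x in lebesgue. \<bar>F x\<bar> \<le> B"
      using Linf_norm_AE[of f\<^sub>0 lebesgue] F(2) by eventually_elim (simp add: real)
    then have FB: "\<bar>F x\<bar> \<le> B" for x
      by (rule AE_continuous_le) (auto intro!: continuous_intros F(1))
    have "\<bar>h_R f t X\<bar> \<le> B / \<bar>1 - U\<bar>" for X
    proof -
      have "\<bar>F (X - U * t) - F (X - t)\<bar> \<le> 2 * B"
        using FB[of "X - U * t"] FB[of "X - t"] by linarith
      then have "\<bar>F (X - U * t) - F (X - t)\<bar> / (2 * \<bar>1 - U\<bar>) \<le> 2 * B / (2 * \<bar>1 - U\<bar>)"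
        by (intro divide_right_mono) auto
      then show ?thesis
        unfolding h_R abs_divide abs_mult by simp
    qed
    then show ?thesis
      using assms(3) by (intro Linf_norm_leI[OF meas]) (simp add: real)
  next
    \<comment> \<open>Division by the positive real \<open>\<bar>1 - U\<bar>\<close> keeps the right
      side infinite.\<close>
    case PInf
    then show ?thesis using assms(3) by simp
  next
    case MInf
    then show ?thesis
      using AE_lebesgue_imp_ex[OF Linf_norm_AE[of f\<^sub>0]] by simp
  qed
  ultimately show ?thesis by simp
qed

end

theorem proposition3p5:
  fixes f :: "real \<Rightarrow> real \<Rightarrow> real"
  assumes "in_Linf_H1 f"
    and "in_Linf half_plane (dX f)"
  shows "(\<forall>X t. t > 0 \<longrightarrow> ereal \<bar>h_R f t X\<bar> \<le> ereal (t / 2) * Linf_norm half_plane (dX f))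
    \<and> (\<forall>f\<^sub>0 t\<^sub>0 X\<^sub>0.
         in_H1 f\<^sub>0 \<and> (\<forall>t\<ge>0. \<forall>X. f t X = f\<^sub>0 (X - t)) \<and> t\<^sub>0 > 0 \<and>
         ereal \<bar>wderiv f\<^sub>0 (X\<^sub>0 - t\<^sub>0)\<bar> = Linf_norm lebesgue (wderiv f\<^sub>0)
         \<longrightarrow> ereal \<bar>h_R f t\<^sub>0 X\<^sub>0\<bar> = ereal (t\<^sub>0 / 2) * Linf_norm half_plane (dX f))
    \<and> (\<forall>f\<^sub>0 U.
         in_H1 f\<^sub>0 \<and> (\<forall>t\<ge>0. \<forall>X. f t X = f\<^sub>0 (X - U * t)) \<and> U \<noteq> 1
         \<longrightarrow> (\<forall>t>0. Linf_norm lebesgue (h_R f t)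
               \<le> min (Linf_norm lebesgue f\<^sub>0 / ereal \<bar>1 - U\<bar>)
                     (ereal (t / 2) * Linf_norm lebesgue (wderiv f\<^sub>0))))"
proof (intro conjI allI impI)
  show "ereal \<bar>h_R f t X\<bar> \<le> ereal (t / 2) * Linf_norm half_plane (dX f)" if "t > 0" for X t
    using h_R_bound[OF assms that] .
next
  fix f\<^sub>0 :: "real \<Rightarrow> real" and t\<^sub>0 X\<^sub>0 :: real
  assume *: "in_H1 f\<^sub>0 \<and> (\<forall>t\<ge>0. \<forall>X. f t X = f\<^sub>0 (X - t)) \<and> t\<^sub>0 > 0 \<and>
    ereal \<bar>wderiv f\<^sub>0 (X\<^sub>0 - t\<^sub>0)\<bar> = Linf_norm lebesgue (wderiv f\<^sub>0)"
  then obtain g where g: "has_weak_deriv f\<^sub>0 g"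
    by (auto simp: in_H1_def)
  have trav: "f t X = f\<^sub>0 (X - 1 * t)" if "t \<ge> 0" for t X
    using * that by simp
  \<comment> \<open>With \<open>U = 1\<close> the variable \<open>\<tau>\<close> drops out of the
    integrand, so the integral is a constant times the length \<open>t\<^sub>0\<close>.\<close>
  have h_R: "h_R f t\<^sub>0 X\<^sub>0 = t\<^sub>0 / 2 * wderiv f\<^sub>0 (X\<^sub>0 - t\<^sub>0)"
    using * travelling_h_R[OF g trav, where t = t\<^sub>0 and X = X\<^sub>0] by (simp add: set_integral_const)
  have "\<bar>h_R f t\<^sub>0 X\<^sub>0\<bar> = t\<^sub>0 / 2 * \<bar>wderiv f\<^sub>0 (X\<^sub>0 - t\<^sub>0)\<bar>"
    unfolding h_R using * by (simp add: abs_mult)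
  then have "ereal \<bar>h_R f t\<^sub>0 X\<^sub>0\<bar> = ereal (t\<^sub>0 / 2) * ereal \<bar>wderiv f\<^sub>0 (X\<^sub>0 - t\<^sub>0)\<bar>"
    by (simp only: times_ereal.simps)
  then show "ereal \<bar>h_R f t\<^sub>0 X\<^sub>0\<bar> = ereal (t\<^sub>0 / 2) * Linf_norm half_plane (dX f)"
    using * travelling_Linf_norm[OF g trav assms(2)] by simp
next
  fix f\<^sub>0 :: "real \<Rightarrow> real" and U t :: real
  assume *: "in_H1 f\<^sub>0 \<and> (\<forall>t\<ge>0. \<forall>X. f t X = f\<^sub>0 (X - U * t)) \<and> U \<noteq> 1" and "t > 0"
  then obtain g where "has_weak_deriv f\<^sub>0 g"
    by (auto simp: in_H1_def)
  then show "Linf_norm lebesgue (h_R f t) \<le> min (Linf_norm lebesgue f\<^sub>0 / ereal \<bar>1 - U\<bar>)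
      (ereal (t / 2) * Linf_norm lebesgue (wderiv f\<^sub>0))"
    using * \<open>t > 0\<close> by (intro travelling_Linf_norm_h_R[OF _ _ assms]) auto
qed

end
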